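(* Let $X$ be a Banach space and let $T,S\in\mathcal{B}(X)$. Then $$\sigma_*(TS)\setminus\{0\}=\sigma_*(ST)\setminus\{0\}$$ for each $*\in\{LBF, RBF, BF\}$.
   Context: $X$ is a complex Banach space and $\mathcal{B}(X)$ the algebra of bounded linear operators on $X$; $\mathcal{N}(T)$ and $\mathcal{R}(T)$ are the null space and range of $T$. For $T\in\mathcal{B}(X)$ let $$\Delta(T)=\{n\in\mathbb{N}: \mathcal{N}(T)\cap\mathcal{R}(T^n)=\mathcal{N}(T)\cap\mathcal{R}(T^m)\text{ for all } m\geq n\},$$ where $\mathbb{N}$ includes $0$, and $\mathrm{dis}(T)=\inf\Delta(T)$, with $\mathrm{dis}(T)=\infty$ if $\Delta(T)=\emptyset$. A subspace is topologically complemented in $X$ if it is closed and has a closed complementary subspace. - $T$ is B-Fredholm if there is a non-negative integer $n$ such that $\mathcal{R}(T^n)$ is closed and the restriction $T|_{\mathcal{R}(T^n)}:\mathcal{R}(T^n)\to\mathcal{R}(T^n)$ is Fredholm. - $T$ is left B-Fredholm if $d:=\mathrm{dis}(T)$ is finite, $\mathcal{N}(T)\cap\mathcal{R}(T^d)$ is finite dimensional, and $\mathcal{R}(T)+\mathcal{N}(T^d)$ is topologically complemented in $X$. - $T$ is right B-Fredholm if $d:=\mathrm{dis}(T)$ is finite, $\mathcal{R}(T)+\mathcal{N}(T^d)$ is closed of finite codimension, and $\mathcal{N}(T)\cap\mathcal{R}(T^d)$ is topologically complemented in $X$. $\sigma_{BF}(T)$, $\sigma_{LBF}(T)$, $\sigma_{RBF}(T)$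 are the sets of $\lambda\in\mathbb{C}$ such that $\lambda-T$ is not B-Fredholm, not left B-Fredholm, not right B-Fredholm, respectively. *)

theory Defs
  imports "HOL-Analysis.Analysis" "HOL-Library.Set_Algebras" "HOL-Library.Extended_Nat"
begin

section \<open>Complex Banach spaces\<close>

text \<open>
  The distribution only provides real Banach spaces. A complex Banach space is a real one
  carrying a multiplication by complex scalars that extends the real scalar multiplication
  and for which the norm is homogeneous.
\<close>

class complex_banach = banach +
  fixes scaleC :: "complex \<Rightarrow> 'a \<Rightarrow> 'a"  (infixr "*\<^sub>C" 75)
  assumes scaleC_add_right: "a *\<^sub>C (x + y) = a *\<^sub>C x + a *\<^sub>C y"
    and scaleC_add_left: "(a + b) *\<^sub>C x = a *\<^sub>C x + b *\<^sub>C x"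
    and scaleC_scaleC: "a *\<^sub>C b *\<^sub>C x = (a * b) *\<^sub>C x"
    and scaleC_one: "1 *\<^sub>C x = x"
    and scaleC_of_real: "complex_of_real r *\<^sub>C x = r *\<^sub>R x"
    and norm_scaleC: "norm (a *\<^sub>C x) = cmod a * norm x"

global_interpretation complex_vector: vector_space "scaleC :: complex \<Rightarrow> 'a \<Rightarrow> 'a::complex_banach"
  by unfold_locales (simp_all add: scaleC_add_right scaleC_add_left scaleC_scaleC scaleC_one)

instantiation complex :: complex_banach
begin

definition scaleC_complex :: "complex \<Rightarrow> complex \<Rightarrow> complex"
  where "scaleC_complex a x = a * x"

instance
  by standard (simp_all add: scaleC_complex_def algebra_simps norm_mult scaleR_conv_of_real)

end

abbreviation csubspace :: "'a::complex_banach set \<Rightarrow> bool"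
  where "csubspace \<equiv> complex_vector.subspace"

abbreviation cspan :: "'a::complex_banach set \<Rightarrow> 'a set"
  where "cspan \<equiv> complex_vector.span"

definition bounded_clinear :: "('a::complex_banach \<Rightarrow> 'a) \<Rightarrow> bool"
  where "bounded_clinear T \<longleftrightarrow> bounded_linear T \<and> (\<forall>a x. T (a *\<^sub>C x) = a *\<^sub>C T x)"

definition null_space :: "('a::complex_banach \<Rightarrow> 'a) \<Rightarrow> 'a set"
  where "null_space T = {x. T x = 0}"

section \<open>Dimension, codimension and complements\<close>

definition finite_dim :: "'a::complex_banach set \<Rightarrow> bool"
  where "finite_dim V \<longleftrightarrow> csubspace V \<and> (\<exists>B. finite B \<and> cspan B = V)"

text \<open>
  \<open>V\<close> has finite codimension in \<open>W\<close>: the quotient \<open>W / V\<close> is spanned by the cosets of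
  the elements of a finite set \<open>B\<close>.
\<close>

definition finite_codim_in :: "'a::complex_banach set \<Rightarrow> 'a set \<Rightarrow> bool"
  where "finite_codim_in V W \<longleftrightarrow>
    csubspace V \<and> csubspace W \<and> V \<subseteq> W \<and> (\<exists>B. finite B \<and> B \<subseteq> W \<and> V + cspan B = W)"

definition top_complemented :: "'a::complex_banach set \<Rightarrow> bool"
  where "top_complemented V \<longleftrightarrow> csubspace V \<and> closed V \<and>
    (\<exists>W. csubspace W \<and> closed W \<and> V \<inter> W = {0} \<and> V + W = UNIV)"

section \<open>B-Fredholm operators and spectra\<close>

definition Delta :: "('a::complex_banach \<Rightarrow> 'a) \<Rightarrow> nat set"
  where "Delta T = {n. \<forall>m\<ge>n.
    null_space T \<inter> range (T ^^ n) = null_space T \<inter> range (T ^^ m)}"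

text \<open>The infimum in \<^typ>\<open>enat\<close> of the empty set is \<open>\<infinity>\<close>.\<close>

definition dis :: "('a::complex_banach \<Rightarrow> 'a) \<Rightarrow> enat"
  where "dis T = Inf (enat ` Delta T)"

text \<open>
  The restriction of \<open>T\<close> to a \<open>T\<close>-invariant subspace \<open>M\<close>, as an operator on \<open>M\<close>, is
  Fredholm: its null space has finite dimension and its range has finite codimension in \<open>M\<close>.
  When \<open>M\<close> is closed and \<open>T\<close> is bounded, the range is then automatically closed.
\<close>

definition fredholm_on :: "'a::complex_banach set \<Rightarrow> ('a \<Rightarrow> 'a) \<Rightarrow> bool"
  where "fredholm_on M T \<longleftrightarrow>
    T ` M \<subseteq> M \<and> finite_dim (null_space T \<inter> M) \<and> finite_codim_in (T ` M) M"

definition B_Fredholm :: "('a::complex_banach \<Rightarrow> 'a) \<Rightarrow> bool"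
  where "B_Fredholm T \<longleftrightarrow> (\<exists>n. closed (range (T ^^ n)) \<and> fredholm_on (range (T ^^ n)) T)"

definition left_B_Fredholm :: "('a::complex_banach \<Rightarrow> 'a) \<Rightarrow> bool"
  where "left_B_Fredholm T \<longleftrightarrow> (\<exists>d. dis T = enat d \<and>
    finite_dim (null_space T \<inter> range (T ^^ d)) \<and>
    top_complemented (range T + null_space (T ^^ d)))"

definition right_B_Fredholm :: "('a::complex_banach \<Rightarrow> 'a) \<Rightarrow> bool"
  where "right_B_Fredholm T \<longleftrightarrow> (\<exists>d. dis T = enat d \<and>
    closed (range T + null_space (T ^^ d)) \<and>
    finite_codim_in (range T + null_space (T ^^ d)) UNIV \<and>
    top_complemented (null_space T \<inter> range (T ^^ d)))"

definition spectrum_BF :: "('a::complex_banach \<Rightarrow> 'a) \<Rightarrow> complex set"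
  where "spectrum_BF T = {l. \<not> B_Fredholm (\<lambda>x. l *\<^sub>C x - T x)}"

definition spectrum_LBF :: "('a::complex_banach \<Rightarrow> 'a) \<Rightarrow> complex set"
  where "spectrum_LBF T = {l. \<not> left_B_Fredholm (\<lambda>x. l *\<^sub>C x - T x)}"

definition spectrum_RBF :: "('a::complex_banach \<Rightarrow> 'a) \<Rightarrow> complex set"
  where "spectrum_RBF T = {l. \<not> right_B_Fredholm (\<lambda>x. l *\<^sub>C x - T x)}"

end

theory Submission
  imports Defs
begin

text \<open>
  Fix \<open>l \<noteq> 0\<close> and put \<open>A = l - T S\<close>, \<open>B = l - S T\<close>. Then \<open>S A = B S\<close> and \<open>A T = T B\<close>, so \<open>S\<close>
  carries null spaces and ranges of powers of \<open>A\<close> into those of \<open>B\<close>, and \<open>T\<close> carries them back.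
  Moreover \<open>T S = l - A\<close>, so up to the nonzero scalar \<open>l\<close> the maps \<open>S\<close> and \<open>T\<close> are mutually
  inverse as soon as \<open>A\<close> and \<open>B\<close> act as zero. This happens in two kinds of places.

  On the null space side, \<open>S\<close> maps \<open>N(A) \<inter> R(A^n)\<close> bijectively onto \<open>N(B) \<inter> R(B^n)\<close>
  (\<open>S_kernel_range\<close>). Hence \<open>A\<close> and \<open>B\<close> have the same degree \<open>dis\<close>, finite dimensionality passes
  from one space to the other, and so does complementation: the preimage under \<open>S\<close> of a complement
  is a complement.

  On the quotient side, if \<open>U\<close> and \<open>V\<close> are subspaces with \<open>R(A) \<subseteq> U\<close>, \<open>R(B) \<subseteq> V\<close>, \<open>S(U) \<subseteq> V\<close> and
  \<open>T(V) \<subseteq> U\<close>, then \<open>S\<close> induces an isomorphism \<open>X/U \<rightarrow> X/V\<close> with inverse induced by \<open>T/l\<close>. In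
  particular \<open>U\<close> is the preimage of \<open>V\<close> under \<open>S\<close>, so it is closed if \<open>V\<close> is
  (\<open>mem_iff_S_mem\<close>), and a finite codimension carries over (\<open>finite_codim_transfer\<close>). If \<open>W\<close> is a
  closed complement of \<open>V\<close>, then \<open>T W\<close> is a complement of \<open>U\<close>. That \<open>T W\<close> is closed is the one
  point that needs analysis: the projection onto \<open>W\<close> along \<open>V\<close> is bounded, by the open mapping
  theorem, and this makes \<open>T\<close> bounded below on \<open>W\<close> (\<open>top_complemented_transfer\<close>).

  For the B-Fredholm property the same isomorphism is applied to \<open>R(A^n)/R(A^(n+1))\<close>, with the same
  \<open>n\<close> for both operators, and closedness of \<open>R(A^n)\<close> follows because it is the preimage of
  \<open>R(B^n)\<close> (\<open>mem_range_pow_iff\<close>). The situation is symmetric in \<open>A\<close> and \<open>B\<close>, so each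
  implication is proved in one direction only.
\<close>

section \<open>The open mapping theorem and closed complements\<close>

lemma Baire_closed_cover:
  fixes E :: "nat \<Rightarrow> 'a::{complete_space, real_normed_vector} set"
  assumes closed: "\<And>n. closed (E n)" and cover: "(\<Union>n. E n) = UNIV"
  shows "\<exists>n. interior (E n) \<noteq> {}"
proof (rule ccontr)
  assume neg: "\<nexists>n. interior (E n) \<noteq> {}"
  have "Met_TC.mtopology interior_of (\<Union>(range E)) = {}"
    by (rule Met_TC.metric_Baire_category_alt) (use neg closed in \<open>auto simp: complete_UNIV\<close>)
  then show False
    using cover interior_of_topspace[of euclidean] by simp
qed

text \<open>
  The open mapping theorem in quantitative form, for the restriction of \<open>f\<close> to a closed subspace
  \<open>M\<close>, which is a Banach space without being a type. By Baire's theorem the closure of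
  \<open>f (M \<inter> n-ball)\<close> contains a ball for some \<open>n\<close>, so every \<open>y\<close> is approximated by some \<open>f x\<close> with an
  error of at most half of \<open>norm y\<close> and with \<open>norm x\<close> controlled. Applying this again to the
  error, and so on, gives a geometrically convergent series of corrections whose sum is an exact
  preimage of \<open>y\<close>.
\<close>
lemma open_mapping_bound:
  fixes f :: "'a::banach \<Rightarrow> 'b::banach"
  assumes f: "bounded_linear f" and M: "subspace M" "closed M" and onto: "f ` M = UNIV"
  shows "\<exists>C. \<forall>y. \<exists>x\<in>M. f x = y \<and> norm x \<le> C * norm y"
proof -
  interpret f: bounded_linear f by (rule f)
  define E where "E n = f ` (M \<inter> cball 0 (real n))" for n
  have "\<exists>n. interior (closure (E n)) \<noteq> {}"
  proof (rule Baire_closed_cover)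
    have "\<exists>n. y \<in> E n" for y
    proof -
      obtain x where "x \<in> M" "f x = y" using onto by (metis UNIV_I imageE)
      moreover obtain n where "norm x \<le> real n" using real_arch_simple by blast
      ultimately have "y \<in> f ` (M \<inter> cball 0 (real n))" by auto
      then show ?thesis unfolding E_def by blast
    qed
    then show "(\<Union>n. closure (E n)) = UNIV"
      using closure_subset by blast
  qed simp
  then obtain n y0 where "y0 \<in> interior (closure (E n))" by blast
  then obtain r where r: "r > 0" and ball: "ball y0 r \<subseteq> closure (E n)"
    by (meson mem_interior)
  define K where "K = 2 * real n / r"
  have K: "K \<ge> 0" using r by (simp add: K_def)
  have approx_ball: "\<exists>x\<in>M. norm x \<le> real n \<and> norm (y - f x) < e" if y: "norm y < r" and e: "e > 0" for y e
  proof -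
    \<comment> \<open>Symmetry and convexity of the image of the ball recentre the ball at \<open>0\<close>.\<close>
    have "y0 + y \<in> closure (E n)" "y0 - y \<in> closure (E n)"
      using y ball by (auto simp: subset_iff dist_norm)
    then obtain p q where p: "p \<in> E n" "dist p (y0 + y) < e" and q: "q \<in> E n" "dist q (y0 - y) < e"
      using e unfolding closure_approachable by blast
    obtain a b where a: "a \<in> M" "norm a \<le> n" "p = f a" and b: "b \<in> M" "norm b \<le> n" "q = f b"
      using p(1) q(1) by (auto simp: E_def)
    have "norm (a - b) \<le> 2 * real n"
      using norm_triangle_ineq4[of a b] a(2) b(2) by linarith
    moreover have "norm (y - f ((1/2) *\<^sub>R (a - b))) < e"
    proof -
      have "y - f ((1/2) *\<^sub>R (a - b)) = (1/2) *\<^sub>R ((q - (y0 - y)) - (p - (y0 + y)))"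
        by (simp add: f.scaleR f.diff a b algebra_simps flip: scaleR_add_left)
      then have "norm (y - f ((1/2) *\<^sub>R (a - b))) \<le> (1/2) * (norm (q - (y0 - y)) + norm (p - (y0 + y)))"
        using norm_triangle_ineq4[of "q - (y0 - y)" "p - (y0 + y)"] by simp
      then show ?thesis using p(2) q(2) by (simp add: dist_norm)
    qed
    moreover have "(1/2) *\<^sub>R (a - b) \<in> M"
      using M(1) a(1) b(1) by (simp add: subspace_diff subspace_scale)
    ultimately show ?thesis by (intro bexI[of _ "(1/2) *\<^sub>R (a - b)"]) auto
  qed
  have approx: "\<exists>x\<in>M. norm x \<le> K * norm y \<and> norm (y - f x) \<le> norm y / 2" for y
  proof (cases "y = 0")
    case True
    then show ?thesis using M(1) by (intro bexI[of _ 0]) (auto simp: f.zero subspace_0)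
  next
    case False
    define c where "c = r / (2 * norm y)"
    have c: "c > 0" "c * norm y = r / 2" using False r by (auto simp: c_def)
    obtain x where x: "x \<in> M" "norm x \<le> n" "norm (c *\<^sub>R y - f x) < r / 4"
      using approx_ball[of "c *\<^sub>R y" "r / 4"] c r by auto
    have "norm ((1/c) *\<^sub>R x) \<le> K * norm y"
      using x(2) c False r by (simp add: K_def c_def field_simps)
    moreover have "norm (y - f ((1/c) *\<^sub>R x)) \<le> norm y / 2"
    proof -
      have "y - f ((1/c) *\<^sub>R x) = (1/c) *\<^sub>R (c *\<^sub>R y - f x)"
        using c by (simp add: f.scaleR algebra_simps)
      then have "norm (y - f ((1/c) *\<^sub>R x)) = norm (c *\<^sub>R y - f x) / c"
        using c by simp
      also have "\<dots> \<le> (r / 4) / c" using x(3) c by (intro divide_right_mono) auto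
      also have "\<dots> = norm y / 2" using c r False by (simp add: c_def field_simps)
      finally show ?thesis .
    qed
    moreover have "(1/c) *\<^sub>R x \<in> M" using M(1) x(1) by (rule subspace_scale)
    ultimately show ?thesis by blast
  qed
  then obtain g where g: "\<And>y. g y \<in> M" "\<And>y. norm (g y) \<le> K * norm y"
      "\<And>y. norm (y - f (g y)) \<le> norm y / 2"
    by metis
  show ?thesis
  proof (intro exI[of _ "2 * K"] allI)
    fix y
    \<comment> \<open>\<open>e k\<close> is the error that remains after \<open>k\<close> corrections.\<close>
    define e where "e k = ((\<lambda>z. z - f (g z)) ^^ k) y" for k
    have e_Suc: "e (Suc k) = e k - f (g (e k))" for k by (simp add: e_def)
    have e_norm: "norm (e k) \<le> norm y * (1/2) ^ k" for k
    proof (induction k)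
      case (Suc k)
      then show ?case using g(3)[of "e k"] by (simp add: e_Suc)
    qed (simp add: e_def)
    have x_norm: "norm (g (e k)) \<le> K * norm y * (1/2) ^ k" for k
      using g(2)[of "e k"] mult_left_mono[OF e_norm[of k] K] by (simp add: mult.assoc)
    have geo: "summable (\<lambda>k. K * norm y * (1/2::real) ^ k)"
      by (intro summable_mult summable_geometric) simp
    have sn: "summable (\<lambda>k. norm (g (e k)))"
      by (rule summable_comparison_test'[OF geo, of 0]) (use x_norm in auto)
    then have s: "summable (\<lambda>k. g (e k))" by (rule summable_norm_cancel)
    let ?x = "\<Sum>k. g (e k)"
    have "?x \<in> M"
    proof (rule Lim_in_closed_set[OF M(2) _ _ summable_LIMSEQ[OF s]])
      show "\<forall>\<^sub>F n in sequentially. (\<Sum>k<n. g (e k)) \<in> M"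
        by (intro always_eventually allI subspace_sum[OF M(1)] g(1))
    qed simp
    moreover have "f ?x = y"
    proof -
      have "(\<lambda>k. norm y * (1/2::real) ^ k) \<longlonglongrightarrow> 0"
        by (intro tendsto_mult_right_zero LIMSEQ_power_zero) simp
      then have "e \<longlonglongrightarrow> 0"
        by (rule Lim_null_comparison[rotated]) (simp add: e_norm)
      then have "(\<lambda>k. f (g (e k))) sums y"
        using telescope_sums'[of e 0] by (simp add: e_Suc) (simp add: e_def)
      then show ?thesis using f.suminf[OF s] by (simp add: sums_iff)
    qed
    moreover have "norm ?x \<le> 2 * K * norm y"
    proof -
      have "norm ?x \<le> (\<Sum>k. norm (g (e k)))" by (rule summable_norm[OF sn])
      also have "\<dots> \<le> (\<Sum>k. K * norm y * (1/2) ^ k)" by (rule suminf_le[OF x_norm sn geo])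
      also have "\<dots> = 2 * K * norm y" by (simp add: suminf_mult suminf_geometric)
      finally show ?thesis .
    qed
    ultimately show "\<exists>x\<in>M. f x = y \<and> norm x \<le> 2 * K * norm y" by blast
  qed
qed

text \<open>
  The projection onto \<open>W\<close> along \<open>V\<close> is bounded: addition \<open>V \<times> W \<rightarrow> X\<close> is a continuous bijection
  between Banach spaces, so its inverse is bounded.
\<close>
lemma closed_complement_bound:
  fixes V W :: "'a::banach set"
  assumes V: "subspace V" "closed V" and W: "subspace W" "closed W"
    and VW: "V \<inter> W = {0}" "V + W = UNIV"
  shows "\<exists>C>0. \<forall>v\<in>V. \<forall>w\<in>W. norm w \<le> C * norm (v + w)"
proof -
  have "bounded_linear (\<lambda>p::'a \<times> 'a. fst p + snd p)"
    by (intro bounded_linear_add bounded_linear_fst bounded_linear_snd)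
  moreover have "subspace (V \<times> W)" "closed (V \<times> W)"
    using V W by (auto intro: subspace_Times closed_Times)
  moreover have "(\<lambda>p. fst p + snd p) ` (V \<times> W) = UNIV"
  proof -
    have "y \<in> (\<lambda>p. fst p + snd p) ` (V \<times> W)" for y
    proof -
      obtain v w where "v \<in> V" "w \<in> W" "y = v + w" using VW(2) by (metis UNIV_I set_plus_elim)
      then show ?thesis by (intro image_eqI[of _ _ "(v, w)"]) auto
    qed
    then show ?thesis by blast
  qed
  ultimately obtain C where C: "\<And>y. \<exists>p\<in>V \<times> W. fst p + snd p = y \<and> norm p \<le> C * norm y"
    using open_mapping_bound by meson
  \<comment> \<open>The maximum only makes the constant positive.\<close>
  have "norm w \<le> max 1 C * norm (v + w)" if "v \<in> V" "w \<in> W" for v w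
  proof -
    obtain p where p: "p \<in> V \<times> W" "fst p + snd p = v + w" "norm p \<le> C * norm (v + w)"
      using C by blast
    have "fst p - v = w - snd p"
      using p(2) by (simp add: algebra_simps)
    moreover have "fst p - v \<in> V" "w - snd p \<in> W"
      using p(1) that V W by (auto intro: subspace_diff)
    ultimately have "w - snd p \<in> V \<inter> W" by simp
    then have "w = snd p" using VW(1) by simp
    then have "norm w \<le> C * norm (v + w)"
      using p(3) norm_snd_le[of "snd p" "fst p"] by simp
    also have "\<dots> \<le> max 1 C * norm (v + w)"
      by (intro mult_right_mono) auto
    finally show ?thesis .
  qed
  then show ?thesis by (intro exI[of _ "max 1 C"]) auto
qed

section \<open>Bounded complex-linear maps and subspaces\<close>

lemma csubspace_imp_subspace: "csubspace V \<Longrightarrow> subspace V"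
  unfolding subspace_def complex_vector.subspace_def by (metis scaleC_of_real)

lemma csubspace_set_plus:
  assumes "csubspace U" "csubspace V"
  shows "csubspace (U + V)"
proof -
  have "U + V = {x + y |x y. x \<in> U \<and> y \<in> V}" by (auto simp: set_plus_def)
  then show ?thesis using complex_vector.subspace_sums[OF assms] by simp
qed

lemma subset_set_plus_left: "csubspace V \<Longrightarrow> U \<subseteq> U + V"
  using set_plus_intro[of _ U 0 V] complex_vector.subspace_0 by fastforce

lemma bounded_clinear_module_hom: "bounded_clinear F \<Longrightarrow> module_hom scaleC scaleC F"
  unfolding bounded_clinear_def
  by (simp add: module_hom_iff complex_vector.module_axioms linear_add bounded_linear.linear)

lemma bounded_clinear_scaleC: "bounded_clinear (\<lambda>x. a *\<^sub>C x)"
proof -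
  have "bounded_linear (\<lambda>x. a *\<^sub>C x :: 'a)"
  proof (rule bounded_linear_intro)
    show "a *\<^sub>C r *\<^sub>R x = r *\<^sub>R a *\<^sub>C x" for r and x :: 'a
      by (simp add: scaleC_scaleC mult.commute flip: scaleC_of_real)
    show "norm (a *\<^sub>C x) \<le> norm x * cmod a" for x :: 'a
      by (simp add: norm_scaleC)
  qed (rule scaleC_add_right)
  then show ?thesis
    by (simp add: bounded_clinear_def scaleC_scaleC mult.commute)
qed

lemma bounded_clinear_scaleC_minus_comp:
  assumes "bounded_clinear F" "bounded_clinear G"
  shows "bounded_clinear (\<lambda>x. l *\<^sub>C x - F (G x))"
  using assms bounded_clinear_scaleC[of l] unfolding bounded_clinear_def
  by (auto intro!: bounded_linear_sub bounded_linear_compose[of F G]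
      simp: complex_vector.scale_right_diff_distrib scaleC_scaleC mult.commute)

lemma bounded_clinear_funpow:
  assumes "bounded_clinear F"
  shows "bounded_clinear (F ^^ n)"
proof (induction n)
  case 0
  then show ?case by (simp add: bounded_clinear_def bounded_linear_ident id_def)
next
  case (Suc n)
  then show ?case
    using assms by (auto simp: bounded_clinear_def intro: bounded_linear_compose[of F "F ^^ n"]
        simp: o_def)
qed

lemma csubspace_range: "bounded_clinear F \<Longrightarrow> csubspace (range F)"
  using module_hom.subspace_image[OF bounded_clinear_module_hom complex_vector.subspace_UNIV] .

lemma csubspace_null_space: "bounded_clinear F \<Longrightarrow> csubspace (null_space F)"
  unfolding null_space_def using module_hom.subspace_kernel[OF bounded_clinear_module_hom] .

lemma finite_dim_image:
  assumes F: "bounded_clinear F" and V: "finite_dim V"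
  shows "finite_dim (F ` V)"
proof -
  interpret F: module_hom scaleC scaleC F using F by (rule bounded_clinear_module_hom)
  obtain X where "finite X" "cspan X = V" using V by (auto simp: finite_dim_def)
  then have "finite (F ` X)" "cspan (F ` X) = F ` V" by (auto simp: F.span_image)
  then show ?thesis using V unfolding finite_dim_def by (auto intro: F.subspace_image)
qed

lemma closed_vimage_bounded_clinear:
  "bounded_clinear F \<Longrightarrow> closed V \<Longrightarrow> closed (F -` V)"
  unfolding bounded_clinear_def
  by (auto intro: continuous_closed_vimage linear_continuous_at)

section \<open>The operators l - T S and l - S T\<close>

text \<open>
  The two operators are parameters tied to \<open>T\<close> and \<open>S\<close> by equations, so that exchanging the roles
  of \<open>T\<close> and \<open>S\<close> yields another instance of the same locale.
\<close>
locale jacobson_pair =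
  fixes T S A B :: "'a::complex_banach \<Rightarrow> 'a" and l :: complex
  assumes T: "bounded_clinear T" and S: "bounded_clinear S"
    and l: "l \<noteq> 0"
    and A_eq: "A x = l *\<^sub>C x - T (S x)" and B_eq: "B x = l *\<^sub>C x - S (T x)"
begin

lemma swap: "jacobson_pair S T B A l"
  using T S l A_eq B_eq by unfold_locales

sublocale T: module_hom scaleC scaleC T using T by (rule bounded_clinear_module_hom)
sublocale S: module_hom scaleC scaleC S using S by (rule bounded_clinear_module_hom)

lemma A: "bounded_clinear A"
proof -
  have "A = (\<lambda>x. l *\<^sub>C x - T (S x))" by (rule ext) (rule A_eq)
  then show ?thesis using bounded_clinear_scaleC_minus_comp[OF T S] by simp
qed

lemma S_A_pow: "S ((A ^^ n) x) = (B ^^ n) (S x)"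
  by (induction n) (simp_all add: A_eq B_eq S.diff S.scale)

lemma S_range: "S ` range (A ^^ n) \<subseteq> range (B ^^ n)"
  by (auto simp: S_A_pow)

lemma S_null_space: "S ` null_space (A ^^ n) \<subseteq> null_space (B ^^ n)"
  by (auto simp: null_space_def S.zero simp flip: S_A_pow)

lemma TS_null_space: "x \<in> null_space A \<Longrightarrow> T (S x) = l *\<^sub>C x"
  by (simp add: null_space_def A_eq)

lemma mem_if_scaleC_mem: "csubspace U \<Longrightarrow> l *\<^sub>C x \<in> U \<Longrightarrow> x \<in> U"
  using complex_vector.subspace_scale[of U "l *\<^sub>C x" "inverse l"] l by (simp add: scaleC_scaleC scaleC_one)

lemma S_kernel_range_subset:
  "S ` (null_space A \<inter> range (A ^^ n)) \<subseteq> null_space B \<inter> range (B ^^ n)"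
  using S_range[of n] S_null_space[of 1] by auto

lemma range_pow_Suc: "range (A ^^ Suc n) \<subseteq> range (A ^^ n)"
  by (auto simp: funpow_swap1)

lemma csubspace_kernel_range: "csubspace (null_space A \<inter> range (A ^^ n))"
  using A by (intro complex_vector.subspace_inter csubspace_null_space csubspace_range bounded_clinear_funpow)

text \<open>
  Since \<open>l x = A x + T S x\<close>, the class of \<open>x\<close> modulo \<open>U\<close> is recovered from that of \<open>S x\<close> modulo \<open>V\<close>
  once \<open>A x\<close> is zero modulo \<open>U\<close>: the map induced by \<open>S\<close> on the quotients is injective there.
\<close>
lemma mem_iff_S_mem:
  assumes "csubspace U" "S ` U \<subseteq> V" "T ` V \<subseteq> U" "A x \<in> U"
  shows "x \<in> U \<longleftrightarrow> S x \<in> V"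
proof
  assume "S x \<in> V"
  then have "A x + T (S x) \<in> U" using assms by (auto intro: complex_vector.subspace_add)
  then show "x \<in> U" using mem_if_scaleC_mem[OF assms(1)] by (simp add: A_eq)
qed (use assms(2) in blast)

text \<open>
  The map \<open>N/V \<rightarrow> M/U\<close> induced by \<open>T\<close> is surjective, because \<open>l x = A x + T S x\<close> and \<open>A\<close> maps \<open>M\<close>
  into \<open>U\<close>. So the images under \<open>T\<close> of finitely many vectors spanning \<open>N\<close> modulo \<open>V\<close> span \<open>M\<close>
  modulo \<open>U\<close>. The ambient spaces \<open>M\<close> and \<open>N\<close> are the whole space for right B-Fredholm operators
  and the ranges of a power for B-Fredholm operators.
\<close>
lemma finite_codim_transfer:
  assumes U: "csubspace U" "csubspace M" "U \<subseteq> M" "A ` M \<subseteq> U"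
    and T_sub: "T ` V \<subseteq> U" "T ` N \<subseteq> M" and S_sub: "S ` M \<subseteq> N"
    and fin: "finite_codim_in V N"
  shows "finite_codim_in U M"
proof -
  obtain X where X: "finite X" "X \<subseteq> N" "V + cspan X = N"
    using fin by (auto simp: finite_codim_in_def)
  have TX: "T ` X \<subseteq> M" using X(2) T_sub(2) by blast
  have "U + cspan (T ` X) = M"
  proof
    have "cspan (T ` X) \<subseteq> M"
      using TX U(2) by (rule complex_vector.span_minimal)
    then show "U + cspan (T ` X) \<subseteq> M"
      using U by (auto elim!: set_plus_elim intro!: complex_vector.subspace_add)
    show "M \<subseteq> U + cspan (T ` X)"
    proof
      fix x assume x: "x \<in> M"
      then obtain v b where v: "v \<in> V" and b: "b \<in> cspan X" and Sx: "S x = v + b"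
        using S_sub X(3) by (metis image_subset_iff set_plus_elim)
      have "l *\<^sub>C x = (A x + T v) + T b"
        using Sx T.add[of v b] by (simp add: A_eq)
      moreover have "A x + T v \<in> U"
        using x v U T_sub complex_vector.subspace_add[OF U(1)] by blast
      moreover have "T b \<in> cspan (T ` X)" using b by (simp add: T.span_image)
      ultimately have "l *\<^sub>C x \<in> U + cspan (T ` X)" by (metis set_plus_intro)
      then show "x \<in> U + cspan (T ` X)"
        using mem_if_scaleC_mem csubspace_set_plus U(1) complex_vector.subspace_span by blast
    qed
  qed
  then show ?thesis
    using X(1) U(1-3) TX unfolding finite_codim_in_def by (intro conjI exI[of _ "T ` X"]) auto
qed

end

context jacobson_pair
begin

interpretation swap: jacobson_pair S T B A l by (rule swap)

section \<open>Null spaces: the intersections of N(A) with R(A^n)\<close>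

text \<open>
  On \<open>N(A)\<close> the composition \<open>T S\<close> is multiplication by \<open>l\<close>, and \<open>S T\<close> is so on \<open>N(B)\<close>; hence
  \<open>T/l\<close> inverts \<open>S\<close> here.
\<close>
lemma S_kernel_range:
  "S ` (null_space A \<inter> range (A ^^ n)) = null_space B \<inter> range (B ^^ n)" (is "S ` ?K = ?L")
proof
  show "?L \<subseteq> S ` ?K"
  proof
    fix y assume y: "y \<in> ?L"
    have "T y \<in> ?K" using swap.S_kernel_range_subset y by blast
    then have "inverse l *\<^sub>C T y \<in> ?K"
      by (rule complex_vector.subspace_scale[OF csubspace_kernel_range])
    moreover have "S (inverse l *\<^sub>C T y) = y"
      using y l by (simp add: S.scale swap.TS_null_space scaleC_scaleC scaleC_one)
    ultimately show "y \<in> S ` ?K" by (metis imageI)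
  qed
qed (rule S_kernel_range_subset)

lemma Delta_subset: "Delta A \<subseteq> Delta B"
  unfolding Delta_def S_kernel_range[symmetric] by (rule Collect_mono) metis

lemma finite_dim_kernel_range:
  "finite_dim (null_space A \<inter> range (A ^^ n)) \<Longrightarrow> finite_dim (null_space B \<inter> range (B ^^ n))"
  using finite_dim_image[OF S] by (metis S_kernel_range)

text \<open>
  If \<open>P\<close> is the projection onto \<open>N(B) \<inter> R(B^n)\<close> along \<open>W\<close>, then \<open>T P S / l\<close> is a projection onto
  \<open>N(A) \<inter> R(A^n)\<close> with null space \<open>S -` W\<close>, which is closed because \<open>S\<close> is continuous.
\<close>
lemma top_complemented_kernel_range:
  assumes "top_complemented (null_space B \<inter> range (B ^^ n))" (is "top_complemented ?L")
  shows "top_complemented (null_space A \<inter> range (A ^^ n))" (is "top_complemented ?K")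
proof -
  obtain W where W: "csubspace W" "closed W" "?L \<inter> W = {0}" "?L + W = UNIV" and "closed ?L"
    using assms unfolding top_complemented_def by blast
  have "?K = null_space A \<inter> S -` ?L"
  proof
    show "null_space A \<inter> S -` ?L \<subseteq> ?K"
    proof
      fix x assume x: "x \<in> null_space A \<inter> S -` ?L"
      then have "T (S x) \<in> ?K" using swap.S_kernel_range_subset by blast
      moreover have "T (S x) = l *\<^sub>C x" using x TS_null_space by blast
      ultimately show "x \<in> ?K"
        using mem_if_scaleC_mem[OF csubspace_kernel_range, of x n] by argo
    qed
  qed (use S_kernel_range_subset in blast)
  moreover have "closed (null_space A)"
    using closed_vimage_bounded_clinear[OF A, of "{0}"] by (simp add: null_space_def vimage_def)
  ultimately have "closed ?K"
    using \<open>closed ?L\<close> closed_vimage_bounded_clinear[OF S] by (metis closed_Int)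
  moreover have "?K \<inter> S -` W = {0}"
  proof -
    have "x = 0" if "x \<in> ?K" "S x \<in> W" for x
    proof -
      have "S x \<in> ?L" using that S_kernel_range_subset by blast
      then have "S x = 0" using that W(3) by blast
      then show ?thesis using TS_null_space[of x] that l by (simp add: T.zero)
    qed
    moreover have "0 \<in> ?K \<inter> S -` W"
      using complex_vector.subspace_0[OF csubspace_kernel_range, of n]
        complex_vector.subspace_0[OF W(1)] by (simp add: S.zero)
    ultimately show ?thesis by blast
  qed
  moreover have "?K + S -` W = UNIV"
  proof -
    have "x \<in> ?K + S -` W" for x
    proof -
      obtain y w where y: "y \<in> ?L" and w: "w \<in> W" and Sx: "S x = y + w"
        using W(4) by (metis UNIV_I set_plus_elim)
      obtain k where k: "k \<in> ?K" "y = S k" using y S_kernel_range by (metis imageE)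
      have "x - k \<in> S -` W" using Sx k w by (simp add: S.diff)
      then show ?thesis using set_plus_intro[OF k(1), of "x - k"] by simp
    qed
    then show ?thesis by blast
  qed
  ultimately show ?thesis
    unfolding top_complemented_def
    using csubspace_kernel_range[of n] S.subspace_vimage[OF W(1)]
      closed_vimage_bounded_clinear[OF S W(2)]
    by (intro conjI exI[of _ "S -` W"])
qed

section \<open>Quotients: complements and preimages\<close>

text \<open>
  As \<open>T\<close> induces an isomorphism \<open>X/V \<rightarrow> X/U\<close>, it maps a complement \<open>W\<close> of \<open>V\<close> injectively onto a
  complement of \<open>U\<close>. For closedness, note that \<open>l w = B w + S T w\<close> with \<open>B w \<in> V\<close>: the projection
  onto \<open>W\<close> along \<open>V\<close> maps \<open>S T w\<close> to \<open>l w\<close>. As it is bounded, \<open>T\<close> is bounded below on \<open>W\<close>.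
\<close>
lemma top_complemented_transfer:
  assumes U: "csubspace U" "range A \<subseteq> U" and V: "csubspace V" "range B \<subseteq> V"
    and SU: "S ` U \<subseteq> V" and TV: "T ` V \<subseteq> U"
    and comp: "top_complemented V"
  shows "top_complemented U"
proof -
  obtain W where W: "csubspace W" "closed W" "V \<inter> W = {0}" "V + W = UNIV" and clV: "closed V"
    using comp by (auto simp: top_complemented_def)
  have U_eq: "x \<in> U \<longleftrightarrow> S x \<in> V" for x
    using mem_iff_S_mem[OF U(1) SU TV] U(2) by blast
  have V_eq: "y \<in> V \<longleftrightarrow> T y \<in> U" for y
    using swap.mem_iff_S_mem[OF V(1) TV SU] V(2) by blast
  have "U = S -` V" using U_eq by blast
  then have "closed U" using closed_vimage_bounded_clinear[OF S clV] by simp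
  moreover have "U \<inter> T ` W = {0}"
  proof -
    have "T w = 0" if "w \<in> W" "T w \<in> U" for w
    proof -
      have "w \<in> V \<inter> W" using V_eq that by simp
      then show ?thesis using W(3) T.zero by simp
    qed
    moreover have "0 \<in> U \<inter> T ` W"
      using complex_vector.subspace_0[OF U(1)]
        complex_vector.subspace_0[OF T.subspace_image[OF W(1)]] by blast
    ultimately show ?thesis by blast
  qed
  moreover have "U + T ` W = UNIV"
  proof -
    have "x \<in> U + T ` W" for x
    proof -
      obtain v w where v: "v \<in> V" and w: "w \<in> W" and Sx: "S x = v + w"
        using W(4) by (metis UNIV_I set_plus_elim)
      have "l *\<^sub>C x = (A x + T v) + T w"
        using Sx T.add[of v w] by (simp add: A_eq)
      moreover have "A x + T v \<in> U"
        using v U TV complex_vector.subspace_add[OF U(1)] by blast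
      ultimately have "l *\<^sub>C x \<in> U + T ` W" using w by (metis imageI set_plus_intro)
      then show ?thesis
        using mem_if_scaleC_mem csubspace_set_plus U(1) T.subspace_image[OF W(1)] by blast
    qed
    then show ?thesis by blast
  qed
  moreover have "closed (T ` W)"
  proof -
    obtain C where C: "C > 0" "\<And>v w. v \<in> V \<Longrightarrow> w \<in> W \<Longrightarrow> norm w \<le> C * norm (v + w)"
      using closed_complement_bound[of V W] V W clV csubspace_imp_subspace by metis
    obtain D where D: "D > 0" "\<And>x. norm (S x) \<le> norm x * D"
      using S bounded_linear.pos_bounded unfolding bounded_clinear_def by blast
    have bound: "norm (T w) \<ge> (cmod l / (C * D)) * norm w" if "w \<in> W" for w
    proof -
      have "- B w \<in> V" using V complex_vector.subspace_neg[OF V(1)] by blast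
      moreover have "l *\<^sub>C w \<in> W" using W(1) that by (rule complex_vector.subspace_scale)
      ultimately have "norm (l *\<^sub>C w) \<le> C * norm (- B w + l *\<^sub>C w)" by (rule C)
      also have "\<dots> = C * norm (S (T w))" by (simp add: B_eq)
      also have "\<dots> \<le> C * (norm (T w) * D)" using C(1) D(2) by simp
      finally show ?thesis using C(1) D(1) by (simp add: norm_scaleC field_simps)
    qed
    have "complete (T ` W)"
    proof (rule complete_isometric_image)
      show "0 < cmod l / (C * D)" using l C(1) D(1) by simp
      show "subspace W" using W(1) by (rule csubspace_imp_subspace)
      show "bounded_linear T" using T by (simp add: bounded_clinear_def)
      show "complete W" using W(2) by (simp add: complete_eq_closed)
    qed (use bound in blast)
    then show ?thesis by (rule complete_imp_closed)
  qed
  ultimately show ?thesis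
    unfolding top_complemented_def using U(1) T.subspace_image[OF W(1)] by blast
qed

lemma csubspace_range_null_space: "csubspace (range A + null_space (A ^^ d))"
  using A by (intro csubspace_set_plus csubspace_range csubspace_null_space bounded_clinear_funpow)

lemma range_subset_range_null_space: "range A \<subseteq> range A + null_space (A ^^ d)"
  using A by (intro subset_set_plus_left csubspace_null_space bounded_clinear_funpow)

lemma S_range_null_space:
  "S ` (range A + null_space (A ^^ d)) \<subseteq> range B + null_space (B ^^ d)"
proof -
  have "S (a + k) \<in> range B + null_space (B ^^ d)" if "a \<in> range A" "k \<in> null_space (A ^^ d)" for a k
  proof -
    have "S a \<in> range B" using S_range[of 1] that by auto
    moreover have "S k \<in> null_space (B ^^ d)" using S_null_space that by blast
    ultimately show ?thesis by (simp add: S.add set_plus_intro)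
  qed
  then show ?thesis by (auto elim!: set_plus_elim)
qed

text \<open>
  In general \<open>A x\<close> is not in \<open>R(A^n)\<close>, so \<open>mem_iff_S_mem\<close> does not apply. Instead, if
  \<open>T S x \<in> R(A^n)\<close>, then the equation \<open>l x = A x + T S x\<close> lifts \<open>x\<close> from \<open>R(A^k)\<close> to \<open>R(A^(k+1))\<close>
  as long as \<open>k < n\<close>, since \<open>A x\<close> lies in \<open>R(A^(k+1))\<close>.
\<close>
lemma mem_range_pow_iff: "x \<in> range (A ^^ n) \<longleftrightarrow> S x \<in> range (B ^^ n)"
proof
  assume "S x \<in> range (B ^^ n)"
  then have TS: "T (S x) \<in> range (A ^^ n)" using swap.S_range by blast
  have "x \<in> range (A ^^ k)" if "k \<le> n" for k
    using that
  proof (induction k)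
    case (Suc k)
    then obtain z where "x = (A ^^ k) z" by auto
    then have "A x \<in> range (A ^^ Suc k)" by simp
    moreover have "range (A ^^ n) \<subseteq> range (A ^^ Suc k)"
      using Suc.prems by (induction rule: dec_induct) (use range_pow_Suc in blast)+
    ultimately have "A x + T (S x) \<in> range (A ^^ Suc k)"
      using TS csubspace_range[OF bounded_clinear_funpow[OF A]] complex_vector.subspace_add by blast
    then have "l *\<^sub>C x \<in> range (A ^^ Suc k)" by (simp only: A_eq diff_add_cancel)
    then show ?case
      using mem_if_scaleC_mem csubspace_range[OF bounded_clinear_funpow[OF A]] by blast
  qed simp
  then show "x \<in> range (A ^^ n)" by blast
qed (use S_range in blast)

lemma A_range_pow: "A ` range (A ^^ n) = range (A ^^ Suc n)"
  by (simp add: image_comp)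

end

context jacobson_pair
begin

interpretation swap: jacobson_pair S T B A l by (rule swap)

section \<open>Transfer of the Fredholm properties from l - S T to l - T S\<close>

lemma dis_eq: "dis A = dis B"
  using Delta_subset swap.Delta_subset by (simp add: dis_def subset_antisym)

lemma closed_range_null_space:
  assumes "closed (range B + null_space (B ^^ d))"
  shows "closed (range A + null_space (A ^^ d))"
proof -
  have "range A + null_space (A ^^ d) = S -` (range B + null_space (B ^^ d))"
    using mem_iff_S_mem[OF csubspace_range_null_space S_range_null_space swap.S_range_null_space]
      range_subset_range_null_space by blast
  then show ?thesis using closed_vimage_bounded_clinear[OF S assms] by simp
qed

lemma left_B_Fredholm_transfer:
  assumes "left_B_Fredholm B"
  shows "left_B_Fredholm A"
proof -
  obtain d where d: "dis B = enat d" "finite_dim (null_space B \<inter> range (B ^^ d))"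
    "top_complemented (range B + null_space (B ^^ d))"
    using assms unfolding left_B_Fredholm_def by blast
  have "top_complemented (range A + null_space (A ^^ d))"
    using csubspace_range_null_space range_subset_range_null_space
      swap.csubspace_range_null_space swap.range_subset_range_null_space
      S_range_null_space swap.S_range_null_space d(3) by (rule top_complemented_transfer)
  then show ?thesis
    using d dis_eq swap.finite_dim_kernel_range unfolding left_B_Fredholm_def by metis
qed

lemma right_B_Fredholm_transfer:
  assumes "right_B_Fredholm B"
  shows "right_B_Fredholm A"
proof -
  obtain d where d: "dis B = enat d" "closed (range B + null_space (B ^^ d))"
    "finite_codim_in (range B + null_space (B ^^ d)) UNIV"
    "top_complemented (null_space B \<inter> range (B ^^ d))"
    using assms unfolding right_B_Fredholm_def by blast
  have "finite_codim_in (range A + null_space (A ^^ d)) UNIV"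
    by (rule finite_codim_transfer[OF _ _ _ _ swap.S_range_null_space _ _ d(3)])
      (simp_all add: csubspace_range_null_space range_subset_range_null_space)
  then show ?thesis
    using d dis_eq closed_range_null_space top_complemented_kernel_range
    unfolding right_B_Fredholm_def by metis
qed

lemma B_Fredholm_transfer:
  assumes "B_Fredholm B"
  shows "B_Fredholm A"
proof -
  obtain n where n: "closed (range (B ^^ n))" "finite_dim (null_space B \<inter> range (B ^^ n))"
    "finite_codim_in (B ` range (B ^^ n)) (range (B ^^ n))"
    using assms unfolding B_Fredholm_def fredholm_on_def by blast
  have csub: "csubspace (range (A ^^ k))" for k
    by (rule csubspace_range[OF bounded_clinear_funpow[OF A]])
  have "range (A ^^ n) = S -` range (B ^^ n)" using mem_range_pow_iff by blast
  then have "closed (range (A ^^ n))" using closed_vimage_bounded_clinear[OF S n(1)] by simp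
  moreover have "finite_codim_in (range (A ^^ Suc n)) (range (A ^^ n))"
    using csub csub range_pow_Suc equalityD1[OF A_range_pow] swap.S_range swap.S_range S_range
      n(3)[unfolded swap.A_range_pow]
    by (rule finite_codim_transfer)
  moreover have "A ` range (A ^^ n) \<subseteq> range (A ^^ n)"
    using range_pow_Suc by (simp only: A_range_pow)
  ultimately show ?thesis
    using swap.finite_dim_kernel_range[OF n(2)] unfolding B_Fredholm_def fredholm_on_def A_range_pow
    by blast
qed

end

section \<open>The punctured spectra of T S and S T\<close>

theorem corollary5p2:
  fixes T S :: "'a::complex_banach \<Rightarrow> 'a"
  assumes "bounded_clinear T" and "bounded_clinear S"
  shows "spectrum_LBF (T \<circ> S) - {0} = spectrum_LBF (S \<circ> T) - {0} \<and>
         spectrum_RBF (T \<circ> S) - {0} = spectrum_RBF (S \<circ> T) - {0} \<and>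
         spectrum_BF (T \<circ> S) - {0} = spectrum_BF (S \<circ> T) - {0}"
proof -
  have pair: "jacobson_pair T S (\<lambda>x. l *\<^sub>C x - (T \<circ> S) x) (\<lambda>x. l *\<^sub>C x - (S \<circ> T) x) l"
    if "l \<noteq> 0" for l
    using assms that by unfold_locales simp_all
  note pair' = pair[THEN jacobson_pair.swap]
  show ?thesis
    unfolding spectrum_LBF_def spectrum_RBF_def spectrum_BF_def
    using pair[THEN jacobson_pair.left_B_Fredholm_transfer]
      pair'[THEN jacobson_pair.left_B_Fredholm_transfer]
      pair[THEN jacobson_pair.right_B_Fredholm_transfer]
      pair'[THEN jacobson_pair.right_B_Fredholm_transfer]
      pair[THEN jacobson_pair.B_Fredholm_transfer]
      pair'[THEN jacobson_pair.B_Fredholm_transfer]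
    by (intro conjI) blast+
qed

end
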